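(* Let $c_2\in[\frac49,1]$. Consider the three-stage EERK3-1 method $$U^{n,1}=u_h^{n-1},\qquad U^{n,i+1}=U^{n,1}+\sum_{j=1}^{i}a_{i+1,j}(-\tau L_\kappa)\left[\tau g_\kappa(U^{n,j})-\tau L_\kappa U^{n,1}\right]\ (1\le i\le3),\qquad u_h^n=U^{n,4},$$ with $a_{21}(z)=c_2\varphi_1(c_2z)$, $a_{31}(z)=\frac23\varphi_1(\frac{2z}3)-\frac4{9c_2}\varphi_2(\frac{2z}3)$, $a_{32}(z)=\frac4{9c_2}\varphi_2(\frac{2z}3)$, $a_{41}(z)=\varphi_1(z)-\frac32\varphi_2(z)$, $a_{42}(z)=0$, $a_{43}(z)=\frac32\varphi_2(z)$, where $g_h$ is Lipschitz continuous with constant $\ell_g>0$ and $\kappa\ge2\ell_g$. Then the method preserves the energy dissipation law at all stages: for every $\tau>0$, $n\ge1$ and $1\le j\le3$, $$E[U^{n,j+1}]-E[U^{n,1}]\le-\frac1\tau\sum_{k=1}^{j}\Big\langle\delta_\tau U^{n,k+1},\sum_{\ell=1}^{k}d^{(3,1)}_{k\ell}(c_2,-\tau L_\kappa)\,\delta_\tau U^{n,\ell+1}\Big\rangle\le0,$$ where $\delta_\tau U^{n,k+1}:=U^{n,k+1}-U^{n,k}$ and $D^{(3,1)}(c_2,z)=(d^{(3,1)}_{k\ell}(c_2,z))$ is $$\begin{pmatrix}\frac1{c_2\varphi_1(c_2z)}+\frac z2&0&0\\[4pt]\frac{9c_2}{4\varphi_2(\frac{2z}3)}+\frac1{c_2\varphi_1(c_2z)}-\frac{3\varphi_1(\frac{2z}3)}{2\varphi_2(\frac{2z}3)\varphi_1(c_2z)}+z&\frac{9c_2}{4\varphi_2(\frac{2z}3)}+\frac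 z2&0\\[4pt]\frac{2c_2\varphi_1(c_2z)-2\varphi_1(z)+3\varphi_2(z)}{3c_2\varphi_1(c_2z)\varphi_2(z)}+z&\frac2{3\varphi_2(z)}+z&\frac2{3\varphi_2(z)}+\frac z2\end{pmatrix}.$$
   Context: $\langle u,v\rangle=v^Tu$ and $\|v\|=\sqrt{\langle v,v\rangle}$ on $\mathbb{R}^M$; Lipschitz is with respect to $\|\cdot\|$. $L_h\in\mathbb{R}^{M\times M}$ is symmetric positive definite. $G_h\ge0$ is a non-negative Lyapunov function with $g_h(v)=-\frac{\delta}{\delta v}G_h(v)$, i.e. the gradient of the scalar function $v\mapsto\langle G_h(v),1\rangle$ is $-g_h(v)$, where $1$ is the all-ones vector. The energy is $E[v]=\frac12\langle v,L_hv\rangle+\langle G_h(v),1\rangle$. Stabilized operators: $L_\kappa:=L_h+\kappa I$, $g_\kappa(u):=g_h(u)+\kappa u$. $\varphi_0(z)=e^z$, $\varphi_{k+1}(z)=(\varphi_k(z)-1/k!)/z$ (entire functions, extended continuously to $z=0$). For a function $f$, $f(-\tau L_\kappa)$ is the matrix function defined through the spectrum of the symmetric matrix $-\tau L_\kappa$. *)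

theory Defs
  imports "HOL-Analysis.Analysis"
begin

text \<open>
  The functions \<open>\<phi>\<^sub>k\<close>, restricted to the real line: they are only ever evaluated at real scalars and
  at eigenvalues of real symmetric matrices.  The value at \<open>0\<close> is the continuous extension, as
  \<open>isCont_phi\<close> below confirms.
\<close>

fun phi :: "nat \<Rightarrow> real \<Rightarrow> real" where
  "phi 0 z = exp z"
| "phi (Suc k) z = (if z = 0 then 1 / fact (Suc k) else (phi k z - 1 / fact k) / z)"

lemma phi_sums: "(\<lambda>n. 1 / fact (n + k) * z ^ n) sums phi k z"
proof (induction k)
  case 0
  show ?case using exp_converges[of z] by (simp add: divide_inverse)
next
  case (Suc k)
  show ?case
  proof (cases "z = 0")
    case True
    then show ?thesis using powser_sums_zero[of "\<lambda>n. 1 / fact (n + Suc k) :: real"] by simp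
  next
    case False
    from Suc have "(\<lambda>n. 1 / fact (Suc n + k) * z ^ Suc n) sums (phi k z - 1 / fact k)"
      by (subst sums_Suc_iff) simp
    then have "(\<lambda>n. 1 / fact (Suc n + k) * z ^ Suc n / z) sums ((phi k z - 1 / fact k) / z)"
      by (rule sums_divide)
    with False show ?thesis by simp
  qed
qed

lemma isCont_phi: "isCont (phi k) z"
proof -
  have "phi k = (\<lambda>z. \<Sum>n. 1 / fact (n + k) * z ^ n)"
    using phi_sums by (auto simp: sums_iff)
  moreover have "isCont (\<lambda>z. \<Sum>n. 1 / fact (n + k) * z ^ n) z"
    by (rule isCont_powser_converges_everywhere) (use phi_sums sums_summable in blast)
  ultimately show ?thesis by simp
qed

definition diag_matrix :: "('m \<Rightarrow> real) \<Rightarrow> real ^ 'm ^ 'm" where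
  "diag_matrix d = (\<chi> i j. if i = j then d i else 0)"

text \<open>
  \<open>f(A) = Q diag(f(\<lambda>\<^sub>i)) Q\<^sup>T\<close> for any orthogonal diagonalization \<open>A = Q diag(\<lambda>\<^sub>i) Q\<^sup>T\<close> of a symmetric
  matrix \<open>A\<close>; by \<open>matrix_fun_eq\<close> below the result does not depend on the diagonalization.  For a
  matrix that is not symmetric the value is unspecified.
\<close>

definition matrix_fun :: "(real \<Rightarrow> real) \<Rightarrow> real ^ 'm ^ 'm \<Rightarrow> real ^ 'm ^ 'm" where
  "matrix_fun f A = (THE B. \<exists>Q d. orthogonal_matrix Q \<and>
     A = Q ** diag_matrix d ** transpose Q \<and>
     B = Q ** diag_matrix (\<lambda>i. f (d i)) ** transpose Q)"

lemma diag_matrix_mult_left: "(diag_matrix d ** M) $ i $ j = d i * M $ i $ j"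
  by (simp add: diag_matrix_def matrix_matrix_mult_def if_distrib[of "\<lambda>x. x * _"] cong: if_cong)

lemma diag_matrix_mult_right: "(M ** diag_matrix d) $ i $ j = M $ i $ j * d j"
  by (simp add: diag_matrix_def matrix_matrix_mult_def if_distrib[of "\<lambda>x. _ * x"] cong: if_cong)

lemma matrix_fun_unique:
  fixes P Q :: "real ^ 'm ^ 'm"
  assumes P: "orthogonal_matrix P" and Q: "orthogonal_matrix Q"
    and eq: "P ** diag_matrix c ** transpose P = Q ** diag_matrix d ** transpose Q"
  shows "P ** diag_matrix (\<lambda>i. f (c i)) ** transpose P = Q ** diag_matrix (\<lambda>i. f (d i)) ** transpose Q"
proof -
  define R where "R = transpose Q ** P"
  have PP: "transpose P ** P = mat 1" "P ** transpose P = mat 1"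
    and QQ: "transpose Q ** Q = mat 1" "Q ** transpose Q = mat 1"
    using P Q by (auto simp: orthogonal_matrix_def)
  have "transpose Q ** (P ** diag_matrix c ** transpose P) ** P =
        transpose Q ** (Q ** diag_matrix d ** transpose Q) ** P"
    by (simp add: eq)
  then have "R ** diag_matrix c ** (transpose P ** P) = (transpose Q ** Q) ** diag_matrix d ** R"
    by (simp add: R_def matrix_mul_assoc)
  then have comm: "R ** diag_matrix c = diag_matrix d ** R"
    by (simp add: PP QQ)
  have "R $ i $ j * f (c j) = f (d i) * R $ i $ j" for i j
  proof -
    have "R $ i $ j * c j = d i * R $ i $ j"
      using comm by (metis diag_matrix_mult_left diag_matrix_mult_right)
    then show ?thesis by auto
  qed
  then have commf: "R ** diag_matrix (\<lambda>i. f (c i)) = diag_matrix (\<lambda>i. f (d i)) ** R"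
    by (simp add: vec_eq_iff diag_matrix_mult_left diag_matrix_mult_right)
  have "P ** diag_matrix (\<lambda>i. f (c i)) ** transpose P
      = (Q ** transpose Q) ** P ** diag_matrix (\<lambda>i. f (c i)) ** transpose P"
    by (simp add: QQ)
  also have "\<dots> = Q ** (R ** diag_matrix (\<lambda>i. f (c i))) ** transpose P"
    by (simp add: R_def matrix_mul_assoc)
  also have "\<dots> = Q ** diag_matrix (\<lambda>i. f (d i)) ** transpose Q ** (P ** transpose P)"
    by (simp only: commf) (simp add: R_def matrix_mul_assoc)
  finally show ?thesis by (simp add: PP)
qed

lemma matrix_fun_eq:
  assumes "orthogonal_matrix Q" "A = Q ** diag_matrix d ** transpose Q"
  shows "matrix_fun f A = Q ** diag_matrix (\<lambda>i. f (d i)) ** transpose Q"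
  unfolding matrix_fun_def
proof (rule the_equality)
  show "\<exists>P c. orthogonal_matrix P \<and> A = P ** diag_matrix c ** transpose P \<and>
     Q ** diag_matrix (\<lambda>i. f (d i)) ** transpose Q = P ** diag_matrix (\<lambda>i. f (c i)) ** transpose P"
    using assms by blast
next
  fix B
  assume "\<exists>P c. orthogonal_matrix P \<and> A = P ** diag_matrix c ** transpose P \<and>
     B = P ** diag_matrix (\<lambda>i. f (c i)) ** transpose P"
  then show "B = Q ** diag_matrix (\<lambda>i. f (d i)) ** transpose Q"
    using assms matrix_fun_unique by blast
qed

text \<open>The inner product with the all-ones vector \<open>1\<close> sums the components of \<open>G v\<close>.\<close>

definition energy :: "real ^ 'm ^ 'm \<Rightarrow> (real ^ 'm \<Rightarrow> real ^ 'm) \<Rightarrow> real ^ 'm \<Rightarrow> real" where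
  "energy L G v = 1 / 2 * (v \<bullet> (L *v v)) + G v \<bullet> 1"

definition stab_L :: "real \<Rightarrow> real ^ 'm ^ 'm \<Rightarrow> real ^ 'm ^ 'm" where
  "stab_L \<kappa> L = L + \<kappa> *\<^sub>R mat 1"

definition stab_g :: "real \<Rightarrow> (real ^ 'm \<Rightarrow> real ^ 'm) \<Rightarrow> real ^ 'm \<Rightarrow> real ^ 'm" where
  "stab_g \<kappa> g u = g u + \<kappa> *\<^sub>R u"

definition eerk31_a :: "real \<Rightarrow> nat \<Rightarrow> nat \<Rightarrow> real \<Rightarrow> real" where
  "eerk31_a c\<^sub>2 i j z =
    (if (i, j) = (2, 1) then c\<^sub>2 * phi 1 (c\<^sub>2 * z)
     else if (i, j) = (3, 1) then 2 / 3 * phi 1 (2 * z / 3) - 4 / (9 * c\<^sub>2) * phi 2 (2 * z / 3)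
     else if (i, j) = (3, 2) then 4 / (9 * c\<^sub>2) * phi 2 (2 * z / 3)
     else if (i, j) = (4, 1) then phi 1 z - 3 / 2 * phi 2 z
     else if (i, j) = (4, 3) then 3 / 2 * phi 2 z
     else 0)"

definition eerk31_d :: "real \<Rightarrow> nat \<Rightarrow> nat \<Rightarrow> real \<Rightarrow> real" where
  "eerk31_d c\<^sub>2 k l z =
    (if (k, l) = (1, 1) then 1 / (c\<^sub>2 * phi 1 (c\<^sub>2 * z)) + z / 2
     else if (k, l) = (2, 1) then
       9 * c\<^sub>2 / (4 * phi 2 (2 * z / 3)) + 1 / (c\<^sub>2 * phi 1 (c\<^sub>2 * z))
       - 3 * phi 1 (2 * z / 3) / (2 * phi 2 (2 * z / 3) * phi 1 (c\<^sub>2 * z)) + z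
     else if (k, l) = (2, 2) then 9 * c\<^sub>2 / (4 * phi 2 (2 * z / 3)) + z / 2
     else if (k, l) = (3, 1) then
       (2 * c\<^sub>2 * phi 1 (c\<^sub>2 * z) - 2 * phi 1 z + 3 * phi 2 z)
       / (3 * c\<^sub>2 * phi 1 (c\<^sub>2 * z) * phi 2 z) + z
     else if (k, l) = (3, 2) then 2 / (3 * phi 2 z) + z
     else if (k, l) = (3, 3) then 2 / (3 * phi 2 z) + z / 2
     else 0)"

end

theory Submission
  imports Defs
begin

text \<open>
  The lower triangular matrix \<open>D\<close> arises by solving the stage equations for the nonlinear terms: the
  \<open>k\<close>-th row of \<open>D\<close> applied to the increments equals
  \<open>\<tau> g\<^sub>\<kappa>(U\<^sub>k) - \<tau> L\<^sub>\<kappa> (U\<^sub>k + U\<^bsub>k+1\<^esub>) / 2\<close>.  Testing it with \<open>U\<^bsub>k+1\<^esub> - U\<^sub>k\<close> and comparing the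
  nonlinear energies by the mean value theorem yields the first inequality stage by stage; the error
  \<open>\<ell>\<^sub>g \<parallel>U\<^bsub>k+1\<^esub> - U\<^sub>k\<parallel>\<^sup>2\<close> is absorbed by \<open>\<kappa> \<ge> 2 \<ell>\<^sub>g\<close>.

  The second inequality reduces, in an orthonormal eigenbasis of \<open>L\<close>, to positivity of the quadratic
  form of \<open>D(c\<^sub>2, -x)\<close> for scalars \<open>x > 0\<close>; the first two stages are the case of vanishing last
  increments.  All entries are polynomials in \<open>x\<close>, \<open>c\<^sub>2\<close>, values of \<open>k(v) = v / (e\<^sup>v - 1)\<close>, and
  \<open>\<psi>(v) = 1 / \<phi>\<^sub>2(-v) - v \<in> [1, 2]\<close>.  After dropping a square with coefficient \<open>x / 6\<close> and completing
  the square in the last increment, a binary form remains, whose discriminant is controlled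
  by elementary bounds on \<open>k\<close> alone.
\<close>

subsection \<open>The functions \<open>\<phi>\<^sub>1\<close> and \<open>\<phi>\<^sub>2\<close> on the negative axis\<close>

text \<open>The generating function of the Bernoulli numbers. At \<open>v = 0\<close> it takes the
  value 0 instead of its limit 1, hence the recurring assumption \<open>0 < v\<close>.\<close>

definition bernoulli_fun :: "real \<Rightarrow> real" where
  "bernoulli_fun v = v / (exp v - 1)"

text \<open>Subtracting \<open>v\<close> from \<open>1 / phi 2 (- v)\<close> removes the linear
  growth and leaves a bounded function.\<close>

definition psi :: "real \<Rightarrow> real" where
  "psi v = v / (bernoulli_fun v + v - 1)"

lemma bernoulli_fun_pos: "0 < v \<Longrightarrow> 0 < bernoulli_fun v"
  by (simp add: bernoulli_fun_def)

lemma bernoulli_fun_le_1: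
  assumes "0 < v"
  shows "bernoulli_fun v \<le> 1"
  using assms exp_ge_add_one_self[of v] by (simp add: bernoulli_fun_def field_simps)

text \<open>With the denominator cleared this is \<open>f 0 \<le> f v\<close> for the
  \<open>f\<close> below; its derivative is nonnegative because
  \<open>1 - t \<le> exp (- t)\<close>.\<close>

lemma bernoulli_fun_ge:
  assumes "0 < v"
  shows "1 - v / 2 \<le> bernoulli_fun v"
proof -
  define f where "f = (\<lambda>t::real. (t - 2) * exp t + t + 2)"
  have "f 0 \<le> f v"
  proof (rule DERIV_nonneg_imp_nondecreasing[of 0 v f])
    fix t :: real assume "0 \<le> t"
    have "(1 - t) * exp t \<le> exp (- t) * exp t"
      using exp_ge_add_one_self[of "- t"] by (intro mult_right_mono) auto
    then have "0 \<le> (t - 1) * exp t + 1"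
      by (simp add: mult_exp_exp algebra_simps)
    moreover have "(f has_real_derivative (t - 1) * exp t + 1) (at t)"
      unfolding f_def by (auto intro!: derivative_eq_intros simp: algebra_simps)
    ultimately show "\<exists>y. (f has_real_derivative y) (at t) \<and> 0 \<le> y" by blast
  qed (use assms in simp)
  then have "(2 - v) * (exp v - 1) \<le> 2 * v" by (simp add: f_def algebra_simps)
  moreover have "0 < exp v - 1" using assms by simp
  ultimately show ?thesis by (simp add: bernoulli_fun_def field_simps)
qed

lemma bernoulli_denominator_pos:
  assumes "0 < v"
  shows "0 < bernoulli_fun v + v - 1"
  using bernoulli_fun_ge[OF assms] assms by simp

text \<open>The two bounds on \<open>bernoulli_fun\<close> put the denominator of
  \<open>psi v\<close> between \<open>v / 2\<close> and \<open>v\<close>; this gives both bounds on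
  \<open>psi\<close>.\<close>

lemma psi_ge_1: "0 < v \<Longrightarrow> 1 \<le> psi v"
  using bernoulli_fun_le_1[of v] bernoulli_denominator_pos[of v] by (simp add: psi_def)

lemma psi_le_2: "0 < v \<Longrightarrow> psi v \<le> 2"
  using bernoulli_fun_ge[of v] bernoulli_denominator_pos[of v] by (simp add: psi_def field_simps)

text \<open>Read from right to left, it turns the unbounded-looking terms in the first column of
  \<open>D\<close> into a bounded product.\<close>

lemma psi_mult:
  assumes "0 < v"
  shows "psi v * bernoulli_fun v = v + psi v - psi v * v"
proof -
  have "psi v * (bernoulli_fun v + v - 1) = v"
    using bernoulli_denominator_pos[OF assms] by (simp add: psi_def)
  then show ?thesis by (simp add: algebra_simps)
qed

text \<open>Since \<open>phi 1 z\<close> is the reciprocal of \<open>bernoulli_fun z\<close>, this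
  is the reflection formula \<open>bernoulli_fun (- v) = bernoulli_fun v + v\<close>.\<close>

lemma phi_1_minus:
  assumes "0 < v"
  shows "phi 1 (- v) = 1 / (bernoulli_fun v + v)"
proof -
  have "exp v - 1 > 0" using assms by simp
  then show ?thesis
    using assms by (simp add: bernoulli_fun_def exp_minus field_simps)
qed

lemma phi_2_eq: "z \<noteq> 0 \<Longrightarrow> phi 2 z = (phi 1 z - 1) / z"
  using phi.simps(2)[of 1 z] by (simp add: numeral_2_eq_2 del: phi.simps)

lemma phi_2_minus:
  assumes "0 < v"
  shows "phi 2 (- v) = 1 / (v + psi v)"
proof -
  have k: "0 < bernoulli_fun v" "0 < bernoulli_fun v + v - 1"
    using assms bernoulli_fun_pos bernoulli_denominator_pos by auto
  have "phi 2 (- v) = (1 - phi 1 (- v)) / v"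
    using assms by (simp add: phi_2_eq field_simps del: phi.simps)
  also have "\<dots> = (bernoulli_fun v + v - 1) / (v * (bernoulli_fun v + v))"
    unfolding phi_1_minus[OF assms] using assms k by (simp add: field_simps)
  also have "v * (bernoulli_fun v + v) = (bernoulli_fun v + v - 1) * (v + psi v)"
    using k by (simp add: psi_def field_simps)
  finally show ?thesis using k by simp
qed

text \<open>On the right the factor \<open>c\<close> cancels against the numerator, so only the
  monotonicity of \<open>exp\<close> is involved.\<close>

lemma bernoulli_fun_mono_scaled:
  assumes "0 < x" "0 < c" "c \<le> 1"
  shows "bernoulli_fun x \<le> bernoulli_fun (c * x) / c"
  using assms mult_right_mono[of c 1 x] by (simp add: bernoulli_fun_def frac_le)

text \<open>Both exponentials are powers of \<open>g = exp (x / 3)\<close>. The common factor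
  \<open>g - 1\<close> cancels, and the first bound follows from
  \<open>x / 3 \<le> sinh (x / 3)\<close>; the second needs only a polynomial inequality in
  \<open>g\<close>.\<close>

lemma bernoulli_fun_two_thirds_bounds:
  assumes "0 < x"
  shows "bernoulli_fun (2 * x / 3) \<le> 1 / 3 + 2 / 3 * bernoulli_fun x"
    and "bernoulli_fun x \<le> bernoulli_fun (2 * x / 3)"
proof -
  define g where "g = exp (x / 3)"
  have g: "1 < g" using assms by (simp add: g_def)
  have x: "exp x = g ^ 3" "exp (2 * x / 3) = g ^ 2"
    by (simp_all add: g_def exp_of_nat_mult[symmetric])
  have fac: "g ^ 3 - 1 = (g - 1) * (g ^ 2 + g + 1)" "g ^ 2 - 1 = (g - 1) * (g + 1)"
    by (simp_all add: algebra_simps power2_eq_square power3_eq_cube)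
  have "x / 3 \<le> (g - 1 / g) / 2"
    using real_le_x_sinh[of "x / 3"] assms by (simp add: g_def exp_minus field_simps)
  then have "2 * g * x \<le> 3 * (g ^ 2 - 1)"
    using g by (simp add: field_simps power2_eq_square)
  then have "2 * g * x * g \<le> 3 * (g ^ 2 - 1) * g"
    using g by (intro mult_right_mono) auto
  \<comment> \<open>This is \<open>3 * g \<le> g ^ 2 + g + 1\<close>, that is
    \<open>0 \<le> (g - 1) ^ 2\<close>.\<close>
  also have "\<dots> \<le> (g ^ 2 - 1) * (g ^ 2 + g + 1)"
  proof -
    have "0 \<le> (g ^ 2 - 1) * (g - 1) ^ 2" using g by simp
    then show ?thesis by (simp add: algebra_simps power2_eq_square)
  qed
  finally have *: "2 * x * g ^ 2 \<le> (g ^ 2 - 1) * (g ^ 2 + g + 1)" by (simp add: power2_eq_square algebra_simps)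
  have "bernoulli_fun (2 * x / 3) - 2 / 3 * bernoulli_fun x
      = 2 * x / 3 * (1 / (g ^ 2 - 1) - 1 / (g ^ 3 - 1))"
    unfolding bernoulli_fun_def x by (simp add: right_diff_distrib)
  also have "1 / (g ^ 2 - 1) - 1 / (g ^ 3 - 1) = g ^ 2 / ((g ^ 2 - 1) * (g ^ 2 + g + 1))"
  proof -
    have "g - 1 \<noteq> 0" "g + 1 \<noteq> 0" "g ^ 2 + g + 1 \<noteq> 0" using g by (auto simp: add_pos_pos less_imp_neq[symmetric])
    then show ?thesis unfolding fac by (simp add: divide_simps)
  qed
  also have "2 * x / 3 * (g ^ 2 / ((g ^ 2 - 1) * (g ^ 2 + g + 1))) \<le> 1 / 3"
  proof -
    have "0 < (g ^ 2 - 1) * (g ^ 2 + g + 1)" using g by (simp add: add_pos_pos)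
    then show ?thesis using * by (simp add: field_simps)
  qed
  finally show "bernoulli_fun (2 * x / 3) \<le> 1 / 3 + 2 / 3 * bernoulli_fun x" by simp
  have "3 * (g + 1) \<le> 2 * (g ^ 2 + g + 1)"
  proof -
    have "0 \<le> (g - 1) * (2 * g + 1)" using g by simp
    then show ?thesis by (simp add: algebra_simps power2_eq_square)
  qed
  then have "3 * (g ^ 2 - 1) \<le> 2 * (g ^ 3 - 1)"
    unfolding fac using g mult_left_mono[of "3 * (g + 1)" "2 * (g ^ 2 + g + 1)" "g - 1"]
    by (simp add: algebra_simps)
  moreover have "0 < g ^ 2 - 1" "0 < g ^ 3 - 1" using g by simp_all
  ultimately have "1 / (g ^ 3 - 1) \<le> 2 / (3 * (g ^ 2 - 1))" by (simp add: field_simps)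
  then have "x * (1 / (g ^ 3 - 1)) \<le> x * (2 / (3 * (g ^ 2 - 1)))"
    using assms by (intro mult_left_mono) auto
  then show "bernoulli_fun x \<le> bernoulli_fun (2 * x / 3)"
    unfolding bernoulli_fun_def x by (simp add: mult.commute)
qed

subsection \<open>Positivity of the scalar quadratic form\<close>

lemma quadratic_form_nonneg:
  fixes a b c s t :: real
  assumes "0 < a" "b\<^sup>2 \<le> 4 * a * c"
  shows "0 \<le> a * s\<^sup>2 + b * (s * t) + c * t\<^sup>2"
proof -
  have "4 * a * (a * s\<^sup>2 + b * (s * t) + c * t\<^sup>2) = (2 * a * s + b * t)\<^sup>2 + (4 * a * c - b\<^sup>2) * t\<^sup>2"
    by (simp add: algebra_simps power2_eq_square)
  also have "\<dots> \<ge> 0" using assms by simp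
  finally show ?thesis using assms(1) by (simp add: zero_le_mult_iff)
qed

text \<open>
  To be read with \<open>u = 1 / c\<^sub>2\<close>, \<open>h = k(c\<^sub>2 x) / c\<^sub>2\<close>, \<open>K = k(x)\<close>, \<open>k\<^sub>2 = k(2x/3)\<close>, \<open>A = \<psi>(x)\<close> and
  \<open>w = 9 c\<^sub>2 \<psi>(2x/3) / 4\<close>; then \<open>b\<close> and \<open>e\<close> are the entries \<open>(2,1)\<close> and \<open>(3,1)\<close> of \<open>D\<close>, and the claim
  is positivity of the binary form left after eliminating the third increment.
\<close>

lemma stage_form_bound:
  fixes A B K k\<^sub>2 h u w :: real
  assumes A: "1 \<le> A" "A \<le> 2"
    and K: "0 \<le> K" "K \<le> k\<^sub>2" "k\<^sub>2 \<le> 1 / 3 + 2 / 3 * K" "K \<le> 1"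
    and h: "K \<le> h" "h \<le> u"
    and u: "1 \<le> u" "u \<le> 9 / 4"
    and w: "9 / 4 \<le> w * u" "w * u \<le> 9 / 2"
    and a: "u \<le> a" and N: "w - 1 / 3 \<le> N"
    and b: "b = h + w * (k\<^sub>2 - 2 / 3 * h)" and e: "e = 2 / 3 * (A * K) + h * (1 - 2 / 3 * A)"
  shows "0 < a - 3 * e\<^sup>2 / (8 * A)" "(b - e / 2)\<^sup>2 \<le> 4 * (a - 3 * e\<^sup>2 / (8 * A)) * N"
proof -
  have hK: "0 \<le> (A - 1) * (h - K)" "0 \<le> (2 - A) * (h - K)" using A h by simp_all
  \<comment> \<open>Here \<open>e = h - 2 / 3 * A * (h - K)\<close> decreases in \<open>A\<close>;
    the extremes at \<open>A = 1\<close> and \<open>A = 2\<close> are \<open>(h + 2 * K) / 3\<close>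
    and \<open>(4 * K - h) / 3\<close>.\<close>
  have eub: "\<bar>e\<bar> \<le> (u + 2) / 3"
    unfolding abs_le_iff e using hK K h by (auto simp: algebra_simps)
  have "e\<^sup>2 \<le> ((u + 2) / 3)\<^sup>2" using eub u by (simp add: abs_le_square_iff[symmetric])
  also have "\<dots> \<le> u"
  proof -
    have "(u - 1) * (4 - u) \<ge> 0" using u by simp
    then show ?thesis by (simp add: power2_eq_square field_simps)
  qed
  finally have e2: "e\<^sup>2 \<le> u" .
  have "3 * e\<^sup>2 / (8 * A) \<le> 3 * e\<^sup>2 / 8"
    using A by (intro divide_left_mono) auto
  \<comment> \<open>The constant is \<open>5 / 8 = 1 - 3 / 8\<close>: at most
    \<open>3 / 8 * u\<close> is lost from \<open>a \<ge> u\<close>.\<close>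
  with e2 a have aa: "5 / 8 * u \<le> a - 3 * e\<^sup>2 / (8 * A)" by simp
  then show "0 < a - 3 * e\<^sup>2 / (8 * A)" using u by linarith
  have w1: "1 \<le> w"
  proof (rule ccontr)
    assume "\<not> 1 \<le> w"
    then have "w * u < 1 * u" using u by (intro mult_strict_right_mono) auto
    with w u show False by simp
  qed
  have wu: "w \<le> w * u" using w1 u by (simp add: mult_le_cancel_left1)
  define P where "P = b - e / 2"
  have P: "P = h / 2 + A / 3 * (h - K) + w * (k\<^sub>2 - 2 / 3 * h)"
    by (simp add: P_def b e field_simps)
  \<comment> \<open>The bound on \<open>k\<^sub>2\<close> produces
    \<open>- w * (2 / 3 * (h - K))\<close>, which absorbs \<open>A / 3 * (h - K)\<close> because
    \<open>A \<le> 2\<close> and \<open>1 \<le> w\<close>.\<close>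
  have up: "P \<le> u / 2 + w / 3"
  proof -
    have "w * (k\<^sub>2 - 2 / 3 * h) \<le> w * (1 / 3 + 2 / 3 * K - 2 / 3 * h)"
      using w1 K by (intro mult_left_mono) auto
    moreover have "A / 3 * (h - K) \<le> 2 / 3 * (h - K)"
      using A h by (intro mult_right_mono) auto
    moreover have "2 / 3 * (h - K) \<le> w * (2 / 3 * (h - K))"
      using w1 h mult_right_mono[of 1 w "2 / 3 * (h - K)"] by simp
    moreover have "w * (1 / 3 + 2 / 3 * K - 2 / 3 * h) = w / 3 - w * (2 / 3 * (h - K))"
      by (simp add: diff_divide_distrib algebra_simps)
    ultimately show ?thesis using h unfolding P by linarith
  qed
  \<comment> \<open>Dropping two terms of favourable sign leaves a function linear in
    \<open>h\<close>, which is then bounded by its values at \<open>h = 0\<close> and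
    \<open>h = u\<close>.\<close>
  have lo: "- P \<le> max 0 (2 / 3 * (w * u) - 5 / 6)"
  proof -
    have "K / 3 \<le> w * k\<^sub>2" using K w1 mult_mono[of 1 w K k\<^sub>2] by simp
    moreover have "0 \<le> (A - 1) / 3 * (h - K)" using A h by simp
    moreover have "- P = h * (2 / 3 * w - 5 / 6) - (A - 1) / 3 * (h - K) - (w * k\<^sub>2 - K / 3)"
      unfolding P by (simp add: diff_divide_distrib algebra_simps)
    ultimately have "- P \<le> h * (2 / 3 * w - 5 / 6)" by linarith
    also have "\<dots> \<le> max 0 (2 / 3 * (w * u) - 5 / 6)"
    proof (cases "2 / 3 * w - 5 / 6 \<ge> 0")
      case True
      then have "h * (2 / 3 * w - 5 / 6) \<le> u * (2 / 3 * w - 5 / 6)" using h by (intro mult_right_mono)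
      also have "\<dots> \<le> 2 / 3 * (w * u) - 5 / 6" using u by (simp add: algebra_simps)
      finally show ?thesis by simp
    next
      case False
      then have "h * (2 / 3 * w - 5 / 6) \<le> 0" using K h by (intro mult_nonneg_nonpos) auto
      then show ?thesis by simp
    qed
    finally show ?thesis .
  qed
  define v where "v = w * u"
  have v: "9 / 4 \<le> v" "v \<le> 9 / 2" using w by (simp_all add: v_def)
  \<comment> \<open>The right-hand side is
    \<open>4 * (5 / 8 * u) * (w - 1 / 3) = 5 / 2 * v - 5 / 6 * u\<close> with the last
    \<open>u\<close> at its worst value \<open>9 / 4\<close>.\<close>
  have "P\<^sup>2 \<le> 5 / 2 * v - 15 / 8"
  proof (cases "0 \<le> P")
    case True
    then have "P\<^sup>2 \<le> (u / 2 + w / 3)\<^sup>2" using up by (intro power_mono)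
    also have "\<dots> = u\<^sup>2 / 4 + v / 3 + w\<^sup>2 / 9"
      by (simp add: v_def power2_eq_square algebra_simps)
    also have "w\<^sup>2 \<le> 9 / 2 * v"
      using wu w1 w unfolding v_def power2_eq_square by (intro mult_mono) linarith+
    also have "u\<^sup>2 \<le> (9 / 4)\<^sup>2" using u by (intro power_mono) auto
    finally show ?thesis using v by (simp add: power2_eq_square)
  next
    case False
    then have "- P \<le> 2 / 3 * v - 5 / 6" using lo by (simp add: v_def max_def split: if_splits)
    then have "(- P)\<^sup>2 \<le> (2 / 3 * v - 5 / 6)\<^sup>2" using False by (intro power_mono) auto
    \<comment> \<open>The secant over \<open>[9 / 4, 9 / 2]\<close> bounds \<open>v\<^sup>2\<close>
      by a linear function.\<close>
    moreover have "0 \<le> (v - 9 / 4) * (9 / 2 - v)" using v by simp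
    ultimately show ?thesis using v by (simp add: power2_eq_square algebra_simps)
  qed
  also have "\<dots> \<le> 4 * (5 / 8 * u) * (w - 1 / 3)" using u by (simp add: v_def algebra_simps)
  also have "\<dots> \<le> 4 * (a - 3 * e\<^sup>2 / (8 * A)) * N"
    using aa N w1 u by (intro mult_mono) auto
  finally show "(b - e / 2)\<^sup>2 \<le> 4 * (a - 3 * e\<^sup>2 / (8 * A)) * N" by (simp add: P_def)
qed

text \<open>The reciprocals are \<open>h + x\<close> for \<open>c * phi 1 (- (c * x))\<close> and
  \<open>v + psi v\<close> for \<open>phi 2 (- v)\<close>. In the entries (2,1) and (3,1) the linear
  growth in \<open>x\<close> cancels.\<close>

lemma eerk31_d_eq:
  assumes "0 < x" "0 < c"
  defines "h \<equiv> bernoulli_fun (c * x) / c" and "y \<equiv> 2 * x / 3"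
  shows "eerk31_d c 1 1 (- x) = x / 2 + h"
    and "eerk31_d c 2 1 (- x) = h + 9 / 4 * c * psi y * (bernoulli_fun y - 2 / 3 * h)"
    and "eerk31_d c 2 2 (- x) = 9 / 4 * c * (y + psi y) - x / 2"
    and "eerk31_d c 3 1 (- x) = 2 / 3 * (psi x * bernoulli_fun x) + h * (1 - 2 / 3 * psi x)"
    and "eerk31_d c 3 2 (- x) = 2 / 3 * psi x - x / 3"
    and "eerk31_d c 3 3 (- x) = x / 6 + 2 / 3 * psi x"
proof -
  have y: "0 < y" "x = 3 / 2 * y" using assms by (simp_all add: y_def)
  have cx: "0 < c * x" using assms by simp
  have h: "0 < h" unfolding h_def using bernoulli_fun_pos[OF cx] assms by simp
  have "bernoulli_fun (c * x) = c * h" using assms(2) by (simp add: h_def)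
  then have pcx: "phi 1 (- (c * x)) = 1 / (c * (h + x))"
    unfolding phi_1_minus[OF cx] by (simp add: distrib_left)
  then have pc: "c * phi 1 (- (c * x)) = 1 / (h + x)" using assms(2) by simp
  \<comment> \<open>Going through \<open>phi 2\<close> makes
    \<open>phi 1 (- v) * (v + psi v)\<close> collapse to \<open>psi v\<close>.\<close>
  have p1: "phi 1 (- v) = 1 - v / (v + psi v)" if "0 < v" for v
    using phi_2_minus[OF that] that by (simp add: phi_2_eq field_simps del: phi.simps)
  have arg: "c * - x = - (c * x)" "2 * - x / 3 = - y" by (simp_all add: y_def)
  have pos: "0 < y + psi y" "0 < x + psi x" "0 < h + x"
    using psi_ge_1[OF y(1)] psi_ge_1[OF assms(1)] y(1) assms(1) h by simp_all
  note d = eerk31_d_def arg phi_2_minus[OF y(1)] phi_2_minus[OF assms(1)] pc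
  show "eerk31_d c 1 1 (- x) = x / 2 + h" unfolding d using pos by simp
  show "eerk31_d c 2 2 (- x) = 9 / 4 * c * (y + psi y) - x / 2" unfolding d by simp
  show "eerk31_d c 3 2 (- x) = 2 / 3 * psi x - x / 3" unfolding d by (simp add: field_simps)
  show "eerk31_d c 3 3 (- x) = x / 6 + 2 / 3 * psi x" unfolding d by (simp add: field_simps)
  have "eerk31_d c 2 1 (- x) = 9 / 4 * c * (y + psi y) + (h + x)
      - 3 / 2 * (phi 1 (- y) * (y + psi y)) * (c * (h + x)) - x"
    unfolding eerk31_d_def arg phi_2_minus[OF y(1)] pcx using assms(1,2) by (simp del: phi.simps)
  also have "phi 1 (- y) * (y + psi y) = psi y" unfolding p1[OF y(1)] using pos by (simp add: field_simps)
  \<comment> \<open>By \<open>x = 3 / 2 * y\<close>, the term \<open>3 / 2 * psi y * (c * x)\<close>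
    is \<open>9 / 4 * c * (psi y * y)\<close>, as \<open>psi_mult\<close> requires.\<close>
  also have "9 / 4 * c * (y + psi y) + (h + x) - 3 / 2 * psi y * (c * (h + x)) - x
      = h + 9 / 4 * c * ((y + psi y - psi y * y) - 2 / 3 * (psi y * h))"
    unfolding y(2) by (simp add: field_simps)
  also have "y + psi y - psi y * y = psi y * bernoulli_fun y"
    by (rule psi_mult[OF y(1), symmetric])
  also have "h + 9 / 4 * c * (psi y * bernoulli_fun y - 2 / 3 * (psi y * h))
      = h + 9 / 4 * c * psi y * (bernoulli_fun y - 2 / 3 * h)"
    by (simp add: field_simps)
  finally show "eerk31_d c 2 1 (- x) = h + 9 / 4 * c * psi y * (bernoulli_fun y - 2 / 3 * h)" .
  have "eerk31_d c 3 1 (- x) = (2 / (h + x) - 2 * phi 1 (- x) + 3 / (x + psi x)) / (3 / (h + x) / (x + psi x)) - x"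
  proof -
    have "2 * c * (1 / (c * (h + x))) = 2 / (h + x)" "3 * c * (1 / (c * (h + x))) = 3 / (h + x)"
      using assms(2) by simp_all
    then show ?thesis
      unfolding eerk31_d_def arg phi_2_minus[OF assms(1)] pcx by (simp del: phi.simps)
  qed
  also have "\<dots> = 2 / 3 * (x + psi x) - 2 / 3 * (phi 1 (- x) * (x + psi x)) * (h + x) + (h + x) - x"
  proof -
    have "(2 / H - 2 * f + 3 / S) / (3 / H / S) = 2 / 3 * S - 2 / 3 * (f * S) * H + H"
      if "0 < H" "0 < S" for H S f :: real
      using that by (simp add: field_simps)
    from this[OF pos(3,2)] show ?thesis by (simp only:)
  qed
  also have "phi 1 (- x) * (x + psi x) = psi x" unfolding p1[OF assms(1)] using pos by (simp add: field_simps)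
  also have "2 / 3 * (x + psi x) - 2 / 3 * psi x * (h + x) + (h + x) - x
      = 2 / 3 * (x + psi x - psi x * x) + h * (1 - 2 / 3 * psi x)"
    by (simp add: field_simps)
  finally show "eerk31_d c 3 1 (- x) = 2 / 3 * (psi x * bernoulli_fun x) + h * (1 - 2 / 3 * psi x)"
    unfolding psi_mult[OF assms(1)] .
qed

text \<open>The square \<open>x / 6 * (s\<^sub>2 - s\<^sub>3)\<^sup>2\<close> takes all of the
  \<open>x\<close>-dependence of the last row; completing the square in \<open>s\<^sub>3\<close>
  costs \<open>3 * e\<^sup>2 / (8 * A)\<close>, \<open>e / 2\<close> and \<open>A / 6\<close> in the
  remaining binary form, which \<open>stage_form_bound\<close> handles.\<close>

lemma eerk31_d_form_nonneg:
  fixes c x s\<^sub>1 s\<^sub>2 s\<^sub>3 :: real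
  assumes x: "0 < x" and c: "4 / 9 \<le> c" "c \<le> 1"
  shows "0 \<le> s\<^sub>1 * (eerk31_d c 1 1 (- x) * s\<^sub>1)
    + s\<^sub>2 * (eerk31_d c 2 1 (- x) * s\<^sub>1 + eerk31_d c 2 2 (- x) * s\<^sub>2)
    + s\<^sub>3 * (eerk31_d c 3 1 (- x) * s\<^sub>1 + eerk31_d c 3 2 (- x) * s\<^sub>2 + eerk31_d c 3 3 (- x) * s\<^sub>3)"
proof -
  define y h A B K k\<^sub>2 where "y = 2 * x / 3" and "h = bernoulli_fun (c * x) / c"
    and "A = psi x" and "B = psi y" and "K = bernoulli_fun x" and "k\<^sub>2 = bernoulli_fun y"
  define w b e a N where "w = 9 / 4 * c * B" and "b = h + w * (k\<^sub>2 - 2 / 3 * h)"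
    and "e = 2 / 3 * (A * K) + h * (1 - 2 / 3 * A)"
    and "a = x / 2 + h" and "N = 9 / 4 * c * (y + B) - y - A / 6"
  have y: "0 < y" and c0: "0 < c" and cx: "0 < c * x" using x c by (simp_all add: y_def)
  have A: "1 \<le> A" "A \<le> 2" and B: "1 \<le> B" "B \<le> 2"
    using psi_ge_1 psi_le_2 x y by (simp_all add: A_def B_def)
  have K: "0 \<le> K" "K \<le> k\<^sub>2" "k\<^sub>2 \<le> 1 / 3 + 2 / 3 * K" "K \<le> 1"
    using bernoulli_fun_two_thirds_bounds[OF x] bernoulli_fun_le_1[OF x] bernoulli_fun_pos[OF x]
    by (simp_all add: K_def k\<^sub>2_def y_def)
  have h: "K \<le> h" "h \<le> 1 / c"
    using bernoulli_fun_mono_scaled[OF x c0 c(2)] bernoulli_fun_le_1[OF cx] c0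
    by (simp_all add: K_def h_def divide_right_mono)
  \<comment> \<open>This is \<open>bernoulli_fun_ge\<close> at \<open>c * x\<close>, divided by
    \<open>c\<close>.\<close>
  have a: "1 / c \<le> a"
    using bernoulli_fun_ge[OF cx] c0 by (simp add: a_def h_def field_simps)
  \<comment> \<open>The bound \<open>4 / 9 \<le> c\<close> lets the part of \<open>N\<close> that is
    linear in \<open>y\<close> be dropped.\<close>
  have "0 \<le> (9 / 4 * c - 1) * y" using c y by simp
  then have N: "w - 1 / 3 \<le> N" using A by (simp add: w_def N_def algebra_simps)
  have u: "1 \<le> 1 / c" "1 / c \<le> 9 / 4" using c by (simp_all add: field_simps)
  have w: "9 / 4 \<le> w * (1 / c)" "w * (1 / c) \<le> 9 / 2" using B c0 by (simp_all add: w_def)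
  note bd = stage_form_bound[OF A K h u w a N b_def e_def]
  have "0 \<le> (a - 3 * e\<^sup>2 / (8 * A)) * s\<^sub>1\<^sup>2 + (b - e / 2) * (s\<^sub>1 * s\<^sub>2) + N * s\<^sub>2\<^sup>2"
    by (rule quadratic_form_nonneg[OF bd])
  moreover have "0 \<le> x / 6 * (s\<^sub>2 - s\<^sub>3)\<^sup>2" using x by simp
  moreover have "0 \<le> 2 / 3 * A * (s\<^sub>3 + s\<^sub>2 / 2 + 3 * e / (4 * A) * s\<^sub>1)\<^sup>2" using A by simp
  moreover have "x / 6 * (s\<^sub>2 - s\<^sub>3)\<^sup>2 + 2 / 3 * A * (s\<^sub>3 + s\<^sub>2 / 2 + 3 * e / (4 * A) * s\<^sub>1)\<^sup>2
      + ((a - 3 * e\<^sup>2 / (8 * A)) * s\<^sub>1\<^sup>2 + (b - e / 2) * (s\<^sub>1 * s\<^sub>2) + N * s\<^sub>2\<^sup>2)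
    = s\<^sub>1 * (a * s\<^sub>1) + s\<^sub>2 * (b * s\<^sub>1 + (9 / 4 * c * (y + B) - x / 2) * s\<^sub>2)
      + s\<^sub>3 * (e * s\<^sub>1 + (2 / 3 * A - x / 3) * s\<^sub>2 + (x / 6 + 2 / 3 * A) * s\<^sub>3)"
  proof -
    define r where "r = 3 * e / (4 * A)"
    have r: "A * r = 3 / 4 * e" "3 * e\<^sup>2 / (8 * A) = r * (e / 2)"
      using A by (simp_all add: r_def power2_eq_square)
    have "2 / 3 * A * (s\<^sub>3 + s\<^sub>2 / 2 + r * s\<^sub>1)\<^sup>2
      = 2 / 3 * A * (s\<^sub>3 + s\<^sub>2 / 2)\<^sup>2 + 4 / 3 * (A * r) * s\<^sub>1 * (s\<^sub>3 + s\<^sub>2 / 2) + 2 / 3 * (A * r) * r * s\<^sub>1\<^sup>2"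
      by (simp add: power2_eq_square algebra_simps)
    also have "\<dots> = 2 / 3 * A * (s\<^sub>3 + s\<^sub>2 / 2)\<^sup>2 + e * s\<^sub>1 * (s\<^sub>3 + s\<^sub>2 / 2) + r * (e / 2) * s\<^sub>1\<^sup>2"
      by (simp add: r(1))
    finally show ?thesis
      unfolding r_def[symmetric] r(2)
      by (simp add: N_def y_def power2_eq_square field_simps)
  qed
  moreover have "eerk31_d c 1 1 (- x) = a" "eerk31_d c 2 1 (- x) = b"
    "eerk31_d c 2 2 (- x) = 9 / 4 * c * (y + B) - x / 2" "eerk31_d c 3 1 (- x) = e"
    "eerk31_d c 3 2 (- x) = 2 / 3 * A - x / 3" "eerk31_d c 3 3 (- x) = x / 6 + 2 / 3 * A"
    by (simp_all only: eerk31_d_eq[OF x c0] a_def b_def e_def w_def y_def h_def A_def B_def K_def k\<^sub>2_def)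
  ultimately show ?thesis by (simp only:)
qed

subsection \<open>The spectral theorem for real symmetric matrices\<close>

lemma symmetric_inner:
  fixes A :: "real ^ 'n ^ 'n"
  assumes "transpose A = A"
  shows "(A *v x) \<bullet> y = x \<bullet> (A *v y)"
  by (metis assms dot_lmul_matrix vector_transpose_matrix)

text \<open>A maximizer of the Rayleigh quotient on an invariant subspace is an eigenvector.\<close>

lemma symmetric_matrix_eigenvector:
  fixes A :: "real ^ 'n ^ 'n" and W :: "(real ^ 'n) set"
  assumes A: "transpose A = A" and W: "subspace W" and inv: "\<And>w. w \<in> W \<Longrightarrow> A *v w \<in> W"
    and ne: "\<exists>w \<in> W. w \<noteq> 0"
  obtains v \<mu> where "v \<in> W" "norm v = 1" "A *v v = \<mu> *\<^sub>R v"
proof -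
  let ?S = "W \<inter> sphere 0 1"
  obtain w where w: "w \<in> W" "w \<noteq> 0" using ne by blast
  have "(1 / norm w) *\<^sub>R w \<in> ?S" using w W by (simp add: subspace_scale)
  then have "?S \<noteq> {}" by blast
  moreover have "compact ?S" by (intro closed_Int_compact closed_subspace W compact_sphere)
  moreover have "continuous_on ?S (\<lambda>x. x \<bullet> (A *v x))"
    by (intro continuous_on_inner continuous_on_id linear_continuous_on matrix_vector_mul_bounded_linear)
  ultimately obtain v where v: "v \<in> ?S" and max: "\<And>x. x \<in> ?S \<Longrightarrow> x \<bullet> (A *v x) \<le> v \<bullet> (A *v v)"
    using continuous_attains_sup[of ?S "\<lambda>x. x \<bullet> (A *v x)"] by blast
  define \<mu> where "\<mu> = v \<bullet> (A *v v)"
  \<comment> \<open>On \<open>W\<close> the form \<open>q\<close> is nonnegative and vanishes at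
    \<open>v\<close>, so its first variation at \<open>v\<close> in the direction of the residual
    \<open>z\<close> must vanish.\<close>
  define q where "q x = \<mu> * (x \<bullet> x) - x \<bullet> (A *v x)" for x
  have vW: "v \<in> W" and nv: "norm v = 1" using v by auto
  have q_nonneg: "0 \<le> q x" if x: "x \<in> W" for x
  proof (cases "x = 0")
    case False
    have "(1 / norm x) *\<^sub>R x \<in> ?S" using x W False by (simp add: subspace_scale)
    from max[OF this] have "(x \<bullet> (A *v x)) / (norm x)\<^sup>2 \<le> \<mu>"
      by (simp add: \<mu>_def matrix_vector_mult_scaleR power2_eq_square)
    then show ?thesis using False by (simp add: q_def dot_square_norm field_simps)
  qed (simp add: q_def)
  define z where "z = \<mu> *\<^sub>R v - A *v v"
  have zW: "z \<in> W" unfolding z_def using vW W inv by (simp add: subspace_diff subspace_scale)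
  have qv: "q v = 0" using nv by (simp add: q_def \<mu>_def dot_square_norm)
  have expand: "q (v + t *\<^sub>R z) = 2 * t * (z \<bullet> z) + t\<^sup>2 * q z" for t
  proof -
    have "q (v + t *\<^sub>R z) = q v + 2 * t * (\<mu> * (v \<bullet> z) - (A *v v) \<bullet> z) + t\<^sup>2 * q z"
    proof -
      have "v \<bullet> (A *v z) = (A *v v) \<bullet> z" "z \<bullet> (A *v v) = (A *v v) \<bullet> z" "z \<bullet> v = v \<bullet> z"
        using symmetric_inner[OF A, of v z] by (simp_all add: inner_commute)
      then show ?thesis
        by (simp add: q_def matrix_vector_right_distrib matrix_vector_mult_scaleR inner_add_left
            inner_add_right power2_eq_square) (simp add: algebra_simps)
    qed
    also have "\<mu> * (v \<bullet> z) - (A *v v) \<bullet> z = z \<bullet> z"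
      by (simp add: z_def inner_diff_left)
    finally show ?thesis by (simp add: qv)
  qed
  have "z \<bullet> z = 0"
  proof (rule ccontr)
    assume "z \<bullet> z \<noteq> 0"
    then have zz: "0 < z \<bullet> z" by simp
    \<comment> \<open>Minimizes \<open>2 * t * (z \<bullet> z) + t\<^sup>2 * (q z + 1)\<close>;
      adding 1 keeps the denominator positive even if \<open>q z = 0\<close>.\<close>
    define t where "t = - (z \<bullet> z) / (q z + 1)"
    have qz: "0 \<le> q z" by (rule q_nonneg[OF zW])
    have "0 \<le> 2 * t * (z \<bullet> z) + t\<^sup>2 * q z"
      using q_nonneg[of "v + t *\<^sub>R z"] vW zW W by (simp add: expand subspace_add subspace_scale)
    also have "\<dots> \<le> 2 * t * (z \<bullet> z) + t\<^sup>2 * (q z + 1)" by (simp add: algebra_simps)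
    also have "t\<^sup>2 * (q z + 1) = - t * (z \<bullet> z)"
      using qz by (simp add: t_def power2_eq_square)
    also have "2 * t * (z \<bullet> z) + - t * (z \<bullet> z) = - (z \<bullet> z)\<^sup>2 / (q z + 1)"
      by (simp add: t_def power2_eq_square)
    also have "\<dots> < 0" using zz qz by (simp add: divide_neg_pos)
    finally show False by simp
  qed
  then have "A *v v = \<mu> *\<^sub>R v" by (simp add: z_def)
  with vW nv show ?thesis by (rule that)
qed

text \<open>By symmetry, the orthogonal complement of a set of eigenvectors is invariant. It is
  nontrivial while there are fewer than \<open>CARD('n)\<close> of them, so it supplies one
  more.\<close>

lemma symmetric_matrix_orthonormal_eigenvectors:
  fixes A :: "real ^ 'n ^ 'n"
  assumes A: "transpose A = A" and "k \<le> CARD('n)"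
  shows "\<exists>S. finite S \<and> card S = k \<and> pairwise orthogonal S \<and>
    (\<forall>v \<in> S. norm v = 1 \<and> (\<exists>\<mu>. A *v v = \<mu> *\<^sub>R v))"
  using assms(2)
proof (induction k)
  case 0
  show ?case by (intro exI[of _ "{}"]) auto
next
  case (Suc k)
  then obtain S where S: "finite S" "card S = k" "pairwise orthogonal S"
    and eig: "\<And>v. v \<in> S \<Longrightarrow> norm v = 1 \<and> (\<exists>\<mu>. A *v v = \<mu> *\<^sub>R v)" by auto
  define W where "W = {y. \<forall>x \<in> S. orthogonal x y}"
  have "dim S \<le> card S" using S by (intro dim_le_card span_superset)
  then have "dim S < DIM(real ^ 'n)" using S Suc.prems by simp
  then obtain w where w: "w \<noteq> 0" "\<And>x. x \<in> span S \<Longrightarrow> orthogonal w x"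
    using orthogonal_to_subspace_exists[of S] by blast
  have "w \<in> W" using w(2) by (auto simp: W_def orthogonal_commute span_base)
  have inv: "A *v y \<in> W" if "y \<in> W" for y
  proof -
    have "orthogonal x (A *v y)" if "x \<in> S" for x
    proof -
      obtain \<mu> where "A *v x = \<mu> *\<^sub>R x" using eig \<open>x \<in> S\<close> by blast
      then show ?thesis
        using \<open>y \<in> W\<close> \<open>x \<in> S\<close> by (simp add: orthogonal_def symmetric_inner[OF A, symmetric] W_def)
    qed
    then show ?thesis by (simp add: W_def)
  qed
  have "subspace W" unfolding W_def by (rule subspace_orthogonal_to_vectors)
  from symmetric_matrix_eigenvector[OF A this inv] obtain v \<mu>
    where v: "v \<in> W" "norm v = 1" "A *v v = \<mu> *\<^sub>R v"
    using \<open>w \<in> W\<close> w(1) by metis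
  have "v \<notin> S"
  proof
    assume "v \<in> S"
    then have "orthogonal v v" using v(1) by (simp add: W_def)
    then show False using v(2) by (simp add: orthogonal_self)
  qed
  then show ?case
    using S eig v
    by (intro exI[of _ "insert v S"]) (auto simp: pairwise_insert W_def orthogonal_commute)
qed

theorem symmetric_matrix_diagonalizable:
  fixes A :: "real ^ 'n ^ 'n"
  assumes A: "transpose A = A"
  obtains Q d where "orthogonal_matrix Q" "A = Q ** diag_matrix d ** transpose Q"
proof -
  obtain S where S: "finite S" "card S = CARD('n)" "pairwise orthogonal S"
    and eig: "\<And>v. v \<in> S \<Longrightarrow> norm v = 1 \<and> (\<exists>\<mu>. A *v v = \<mu> *\<^sub>R v)"
    using symmetric_matrix_orthonormal_eigenvectors[OF A order_refl] by blast
  obtain f :: "'n \<Rightarrow> real ^ 'n" where f: "bij_betw f UNIV S"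
    using finite_same_card_bij[of "UNIV :: 'n set" S] S by auto
  have fS: "f j \<in> S" for j using f by (auto simp: bij_betw_def)
  have "\<forall>j. \<exists>\<mu>. A *v f j = \<mu> *\<^sub>R f j" using eig fS by blast
  then obtain d where d: "\<And>j. A *v f j = d j *\<^sub>R f j" by metis
  define Q :: "real ^ 'n ^ 'n" where "Q = (\<chi> i j. f j $ i)"
  have "f i \<bullet> f j = (if i = j then 1 else 0)" for i j
  proof (cases "i = j")
    case True
    then show ?thesis using eig[OF fS[of j]] by (simp add: dot_square_norm)
  next
    case False
    then have "f i \<noteq> f j" using f by (auto simp: bij_betw_def inj_on_def)
    then show ?thesis using S(3) fS False by (auto simp: pairwise_def orthogonal_def)
  qed
  then have "transpose Q ** Q = mat 1"
    by (simp add: vec_eq_iff matrix_matrix_mult_def transpose_def Q_def mat_def inner_vec_def)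
  then have Q: "orthogonal_matrix Q" by (simp add: orthogonal_matrix)
  have "(A ** Q) $ i $ j = (Q ** diag_matrix d) $ i $ j" for i j
    using arg_cong[OF d[of j], of "\<lambda>v. v $ i"]
    by (simp add: diag_matrix_mult_right) (simp add: Q_def matrix_matrix_mult_def matrix_vector_mult_def)
  then have "A ** Q = Q ** diag_matrix d" by (simp add: vec_eq_iff)
  then have "A ** (Q ** transpose Q) = Q ** diag_matrix d ** transpose Q"
    by (simp add: matrix_mul_assoc)
  then show ?thesis using Q that by (simp add: orthogonal_matrix_def)
qed

subsection \<open>Coordinates in an orthonormal eigenbasis\<close>

lemma transpose_matrix_vector_nth: "(transpose Q *v v) $ i = column i Q \<bullet> v"
  for Q :: "real ^ 'n ^ 'm"
  by (simp add: matrix_vector_mult_def transpose_def column_def inner_vec_def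
      del: transpose_matrix_vector)

lemma diag_matrix_vector_nth: "(diag_matrix d *v v) $ i = d i * v $ i"
  by (simp add: diag_matrix_def matrix_vector_mult_def if_distrib[of "\<lambda>x. x * _"] cong: if_cong)

text \<open>The columns of \<open>Q\<close> are common eigenvectors of all functions of
  \<open>A\<close>, so vector relations split into scalar ones, one per eigenvalue.\<close>

lemma matrix_fun_coordinate:
  assumes "orthogonal_matrix Q" "A = Q ** diag_matrix d ** transpose Q"
  shows "column i Q \<bullet> (matrix_fun f A *v v) = f (d i) * (column i Q \<bullet> v)"
proof -
  have "transpose Q *v (matrix_fun f A *v v)
      = (transpose Q ** Q) *v (diag_matrix (\<lambda>i. f (d i)) *v (transpose Q *v v))"
    by (simp add: matrix_fun_eq[OF assms] matrix_vector_mul_assoc matrix_mul_assoc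
        del: transpose_matrix_vector)
  also have "\<dots> = diag_matrix (\<lambda>i. f (d i)) *v (transpose Q *v v)"
    using assms(1) by (simp add: orthogonal_matrix_def del: transpose_matrix_vector)
  also have "\<dots> $ i = f (d i) * (transpose Q *v v) $ i"
    by (rule diag_matrix_vector_nth)
  finally show ?thesis by (simp only: transpose_matrix_vector_nth)
qed

text \<open>Makes \<open>matrix_fun_coordinate\<close> applicable to \<open>A\<close>
  itself.\<close>

lemma matrix_fun_id:
  assumes "orthogonal_matrix Q" "A = Q ** diag_matrix d ** transpose Q"
  shows "matrix_fun (\<lambda>z. z) A = A"
  using matrix_fun_eq[OF assms] assms(2) by simp

lemma orthogonal_matrix_inner:
  fixes Q :: "real ^ 'n ^ 'n"
  assumes "orthogonal_matrix Q"
  shows "x \<bullet> y = (\<Sum>i\<in>UNIV. (column i Q \<bullet> x) * (column i Q \<bullet> y))"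
proof -
  have "(\<Sum>i\<in>UNIV. (column i Q \<bullet> x) * (column i Q \<bullet> y)) = (transpose Q *v x) \<bullet> (transpose Q *v y)"
    unfolding inner_vec_def[of "transpose Q *v x"] transpose_matrix_vector_nth by simp
  also have "\<dots> = x \<bullet> ((Q ** transpose Q) *v y)"
    by (metis dot_lmul_matrix matrix_vector_mul_assoc transpose_matrix_vector)
  finally show ?thesis using assms by (simp add: orthogonal_matrix_def)
qed

lemma orthogonal_matrix_coordinates_eqI:
  fixes Q :: "real ^ 'n ^ 'n"
  assumes "orthogonal_matrix Q" "\<And>i. column i Q \<bullet> x = column i Q \<bullet> y"
  shows "x = y"
  by (rule vector_eq_rdot[THEN iffD1]) (simp add: orthogonal_matrix_inner[OF assms(1), of x]
      orthogonal_matrix_inner[OF assms(1), of y] assms(2))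

lemma negative_definite_eigenvalue:
  fixes A :: "real ^ 'n ^ 'n"
  assumes "orthogonal_matrix Q" "A = Q ** diag_matrix d ** transpose Q"
    and neg: "\<And>v. v \<noteq> 0 \<Longrightarrow> v \<bullet> (A *v v) < 0"
  shows "d i < 0"
proof -
  have "(transpose Q ** Q) $ i $ i = column i Q \<bullet> column i Q"
    by (simp add: matrix_matrix_mult_def transpose_def column_def inner_vec_def)
  then have c: "column i Q \<bullet> column i Q = 1"
    using assms(1) by (simp add: orthogonal_matrix_def mat_def)
  then have "column i Q \<noteq> 0" by auto
  from neg[OF this] show ?thesis
    using matrix_fun_coordinate[OF assms(1,2), of i "\<lambda>z. z" "column i Q"]
    by (simp add: matrix_fun_id[OF assms(1,2)] c)
qed

subsection \<open>Energy dissipation\<close>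

text \<open>The mean value theorem on the segment from \<open>u\<close> to \<open>v\<close> gives
  the constant \<open>K\<close>. Integration would give \<open>K / 2\<close>, but \<open>K\<close>
  is what \<open>2 * K \<le> \<kappa>\<close> can absorb.\<close>

lemma gradient_lipschitz_upper_bound:
  fixes F :: "'a::real_inner \<Rightarrow> real"
  assumes grad: "\<And>v. GDERIV F v :> - g v" and lip: "K-lipschitz_on UNIV g"
  shows "F v - F u \<le> - (g u \<bullet> (v - u)) + K * ((v - u) \<bullet> (v - u))"
proof -
  define p where "p t = u + t *\<^sub>R (v - u)" for t :: real
  have "((\<lambda>t. F (p t)) has_real_derivative - (g (p t) \<bullet> (v - u))) (at t)" for t
  proof -
    have "(p has_derivative (\<lambda>h. h *\<^sub>R (v - u))) (at t)"
      unfolding p_def by (auto intro!: derivative_eq_intros)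
    moreover have "(F has_derivative (\<lambda>h. h \<bullet> - g (p t))) (at (p t))"
      using grad by (simp add: gderiv_def)
    ultimately have "((\<lambda>t. F (p t)) has_derivative (\<lambda>h. (h *\<^sub>R (v - u)) \<bullet> - g (p t))) (at t)"
      by (rule has_derivative_compose)
    then show ?thesis
      by (rule has_derivative_imp_has_field_derivative) (simp add: inner_commute)
  qed
  then obtain t where t: "0 < t" "t < 1" and eq: "F (p 1) - F (p 0) = - (g (p t) \<bullet> (v - u))"
    using MVT2[of 0 1 "\<lambda>t. F (p t)" "\<lambda>t. - (g (p t) \<bullet> (v - u))"] by auto
  have K: "0 \<le> K" using lip by (rule lipschitz_on_nonneg)
  have "norm (g u - g (p t)) \<le> K * norm (u - p t)"
    using lipschitz_onD[OF lip, of u "p t"] by (simp add: dist_norm)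
  also have "norm (u - p t) \<le> norm (v - u)"
    using t mult_right_mono[of t 1 "norm (v - u)"] by (simp add: p_def)
  finally have "norm (g u - g (p t)) * norm (v - u) \<le> K * norm (v - u) * norm (v - u)"
    using K by (intro mult_right_mono) (auto simp: mult_left_mono)
  then have "(g u - g (p t)) \<bullet> (v - u) \<le> K * ((v - u) \<bullet> (v - u))"
    using norm_cauchy_schwarz[of "g u - g (p t)" "v - u"]
    by (simp add: dot_square_norm power2_eq_square)
  then show ?thesis using eq by (simp add: p_def inner_diff_left[of "g u"])
qed

text \<open>By symmetry of \<open>L\<close> the quadratic energies differ by exactly
  \<open>1 / 2 * ((v - u) \<bullet> (L *v (u + v)))\<close>. The stabilization contributes
  \<open>\<kappa> / 2 * ((v - u) \<bullet> (v - u))\<close>, which covers the Lipschitz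
  error.\<close>

lemma energy_step:
  assumes L: "transpose L = L" and grad: "\<And>v. GDERIV (\<lambda>w. G w \<bullet> 1) v :> - g v"
    and lip: "K-lipschitz_on UNIV g" and \<kappa>: "2 * K \<le> \<kappa>"
  shows "energy L G v - energy L G u
    \<le> (v - u) \<bullet> ((1 / 2) *\<^sub>R (stab_L \<kappa> L *v (u + v)) - stab_g \<kappa> g u)"
proof -
  have "G v \<bullet> 1 - G u \<bullet> 1 \<le> - (g u \<bullet> (v - u)) + K * ((v - u) \<bullet> (v - u))"
    by (rule gradient_lipschitz_upper_bound[OF grad lip])
  also have "K * ((v - u) \<bullet> (v - u)) \<le> \<kappa> / 2 * ((v - u) \<bullet> (v - u))"
    using \<kappa> by (intro mult_right_mono) auto
  finally have *: "G v \<bullet> 1 - G u \<bullet> 1 \<le> - (g u \<bullet> (v - u)) + \<kappa> / 2 * ((v - u) \<bullet> (v - u))" by simp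
  have "u \<bullet> (L *v v) = v \<bullet> (L *v u)" using symmetric_inner[OF L, of u v] by (simp add: inner_commute)
  then have "(v - u) \<bullet> (L *v (u + v)) = v \<bullet> (L *v v) - u \<bullet> (L *v u)"
    by (simp add: matrix_vector_right_distrib inner_diff_left inner_add_right)
  moreover have "stab_L \<kappa> L *v (u + v) = L *v (u + v) + \<kappa> *\<^sub>R (u + v)"
    by (simp add: stab_L_def matrix_vector_mult_add_rdistrib scaleR_matrix_vector_assoc[symmetric])
  ultimately have "(v - u) \<bullet> ((1 / 2) *\<^sub>R (stab_L \<kappa> L *v (u + v)) - stab_g \<kappa> g u)
      = 1 / 2 * (v \<bullet> (L *v v) - u \<bullet> (L *v u)) + \<kappa> / 2 * ((v - u) \<bullet> (u + v))
        - (v - u) \<bullet> g u - \<kappa> * ((v - u) \<bullet> u)"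
    by (simp add: stab_g_def inner_diff_right inner_add_right algebra_simps)
  moreover have "(v - u) \<bullet> (u + v) = (v - u) \<bullet> (v - u) + 2 * ((v - u) \<bullet> u)"
    by (simp add: inner_add_right inner_diff_right)
  ultimately show ?thesis using * by (simp add: energy_def inner_commute[of "g u"] algebra_simps)
qed

lemma eerk31_d_matrix_form_nonneg:
  fixes Z :: "real ^ 'n ^ 'n"
  assumes Z: "orthogonal_matrix Q" "Z = Q ** diag_matrix d ** transpose Q" and neg: "\<And>i. d i < 0"
    and c: "4 / 9 \<le> c" "c \<le> 1"
  shows "0 \<le> v\<^sub>1 \<bullet> (matrix_fun (eerk31_d c 1 1) Z *v v\<^sub>1)
    + v\<^sub>2 \<bullet> (matrix_fun (eerk31_d c 2 1) Z *v v\<^sub>1 + matrix_fun (eerk31_d c 2 2) Z *v v\<^sub>2)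
    + v\<^sub>3 \<bullet> (matrix_fun (eerk31_d c 3 1) Z *v v\<^sub>1 + matrix_fun (eerk31_d c 3 2) Z *v v\<^sub>2
        + matrix_fun (eerk31_d c 3 3) Z *v v\<^sub>3)" (is "0 \<le> ?F")
proof -
  let ?h = "\<lambda>v i. column i Q \<bullet> v"
  have "?F = (\<Sum>i\<in>UNIV. ?h v\<^sub>1 i * (eerk31_d c 1 1 (d i) * ?h v\<^sub>1 i)
      + ?h v\<^sub>2 i * (eerk31_d c 2 1 (d i) * ?h v\<^sub>1 i + eerk31_d c 2 2 (d i) * ?h v\<^sub>2 i)
      + ?h v\<^sub>3 i * (eerk31_d c 3 1 (d i) * ?h v\<^sub>1 i + eerk31_d c 3 2 (d i) * ?h v\<^sub>2 i
          + eerk31_d c 3 3 (d i) * ?h v\<^sub>3 i))"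
    unfolding orthogonal_matrix_inner[OF Z(1), of v\<^sub>1] orthogonal_matrix_inner[OF Z(1), of v\<^sub>2]
      orthogonal_matrix_inner[OF Z(1), of v\<^sub>3] inner_add_right matrix_fun_coordinate[OF Z]
    by (simp only: sum.distrib distrib_left)
  also have "\<dots> \<ge> 0"
  proof (rule sum_nonneg)
    fix i
    show "0 \<le> ?h v\<^sub>1 i * (eerk31_d c 1 1 (d i) * ?h v\<^sub>1 i)
      + ?h v\<^sub>2 i * (eerk31_d c 2 1 (d i) * ?h v\<^sub>1 i + eerk31_d c 2 2 (d i) * ?h v\<^sub>2 i)
      + ?h v\<^sub>3 i * (eerk31_d c 3 1 (d i) * ?h v\<^sub>1 i + eerk31_d c 3 2 (d i) * ?h v\<^sub>2 i
          + eerk31_d c 3 3 (d i) * ?h v\<^sub>3 i)"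
      using eerk31_d_form_nonneg[of "- d i" c "?h v\<^sub>1 i" "?h v\<^sub>2 i" "?h v\<^sub>3 i"] neg[of i] c by simp
  qed
  finally show ?thesis .
qed

text \<open>Forward substitution: each stage brings in one new \<open>w\<close> with nonzero
  coefficient, and the third equation skips \<open>w\<^sub>2\<close> because the (4,2) coefficient
  is 0. The multiples of \<open>z\<close> on the right account for the summands \<open>z\<close> and
  \<open>z / 2\<close> in \<open>D\<close>.\<close>

lemma eerk31_stage_inversion:
  fixes c z s\<^sub>1 s\<^sub>2 s\<^sub>3 w\<^sub>1 w\<^sub>2 w\<^sub>3 :: real
  assumes z: "z < 0" and c: "0 < c"
    and s1: "s\<^sub>1 = eerk31_a c 2 1 z * w\<^sub>1"
    and s2: "s\<^sub>1 + s\<^sub>2 = eerk31_a c 3 1 z * w\<^sub>1 + eerk31_a c 3 2 z * w\<^sub>2"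
    and s3: "s\<^sub>1 + s\<^sub>2 + s\<^sub>3 = eerk31_a c 4 1 z * w\<^sub>1 + eerk31_a c 4 2 z * w\<^sub>2 + eerk31_a c 4 3 z * w\<^sub>3"
  shows "eerk31_d c 1 1 z * s\<^sub>1 = w\<^sub>1 + z * (s\<^sub>1 / 2)"
    and "eerk31_d c 2 1 z * s\<^sub>1 + eerk31_d c 2 2 z * s\<^sub>2 = w\<^sub>2 + z * (s\<^sub>1 + s\<^sub>2 / 2)"
    and "eerk31_d c 3 1 z * s\<^sub>1 + eerk31_d c 3 2 z * s\<^sub>2 + eerk31_d c 3 3 z * s\<^sub>3
      = w\<^sub>3 + z * (s\<^sub>1 + s\<^sub>2 + s\<^sub>3 / 2)"
proof -
  define p q r f t where "p = phi 1 (c * z)" and "q = phi 1 (2 * z / 3)" and "r = phi 2 (2 * z / 3)"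
    and "f = phi 1 z" and "t = phi 2 z"
  have pos: "0 < phi 1 v" "0 < phi 2 v" if "v < 0" for v
  proof -
    have v: "0 < - v" using that by simp
    show "0 < phi 1 v" using phi_1_minus[OF v] bernoulli_fun_pos[OF v] v by (simp del: phi.simps One_nat_def)
    show "0 < phi 2 v" using phi_2_minus[OF v] psi_ge_1[OF v] v by (simp del: phi.simps)
  qed
  have cz: "c * z < 0" using z c by (simp add: mult_pos_neg)
  have p: "0 < p" and r: "0 < r" and t: "0 < t"
    unfolding p_def r_def t_def using z by (intro pos cz; simp)+
  note ad = eerk31_a_def eerk31_d_def p_def[symmetric] q_def[symmetric] r_def[symmetric]
    f_def[symmetric] t_def[symmetric]
  have w1: "w\<^sub>1 = s\<^sub>1 / (c * p)" using s1 p c unfolding ad by simp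
  have w2: "w\<^sub>2 = 9 * c / (4 * r) * (s\<^sub>1 + s\<^sub>2 - (2 / 3 * q - 4 / (9 * c) * r) * w\<^sub>1)"
    unfolding s2 unfolding ad using r c by (simp add: field_simps)
  have w3: "w\<^sub>3 = 2 / (3 * t) * (s\<^sub>1 + s\<^sub>2 + s\<^sub>3 - (f - 3 / 2 * t) * w\<^sub>1)"
    unfolding s3 unfolding ad using t by (simp add: field_simps)
  show "eerk31_d c 1 1 z * s\<^sub>1 = w\<^sub>1 + z * (s\<^sub>1 / 2)"
    unfolding ad w1 using p c by (simp add: field_simps)
  show "eerk31_d c 2 1 z * s\<^sub>1 + eerk31_d c 2 2 z * s\<^sub>2 = w\<^sub>2 + z * (s\<^sub>1 + s\<^sub>2 / 2)"
    unfolding ad w2 w1 using p r c by (simp add: field_simps)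
  show "eerk31_d c 3 1 z * s\<^sub>1 + eerk31_d c 3 2 z * s\<^sub>2 + eerk31_d c 3 3 z * s\<^sub>3
      = w\<^sub>3 + z * (s\<^sub>1 + s\<^sub>2 + s\<^sub>3 / 2)"
    unfolding ad w3 w1 using p t c by (simp add: field_simps)
qed

theorem corollary4p1:
  fixes L :: "real ^ 'm ^ 'm"
    and G g :: "real ^ 'm \<Rightarrow> real ^ 'm"
    and u :: "nat \<Rightarrow> real ^ 'm"
    and U :: "nat \<Rightarrow> nat \<Rightarrow> real ^ 'm"
    and c\<^sub>2 \<kappa> \<tau> lg :: real
  assumes L_sym: "transpose L = L"
    and L_pos: "\<And>v. v \<noteq> 0 \<Longrightarrow> 0 < v \<bullet> (L *v v)"
    and G_nonneg: "\<And>v i. 0 \<le> G v $ i"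
    and G_grad: "\<And>v. GDERIV (\<lambda>w. G w \<bullet> 1) v :> - g v"
    and lg_pos: "0 < lg"
    and g_lip: "lg-lipschitz_on UNIV g"
    and kappa: "2 * lg \<le> \<kappa>"
    and c2: "4 / 9 \<le> c\<^sub>2" "c\<^sub>2 \<le> 1"
    and tau: "0 < \<tau>"
    and stage_first: "\<And>n. 1 \<le> n \<Longrightarrow> U n 1 = u (n - 1)"
    and stage_step: "\<And>n i. 1 \<le> n \<Longrightarrow> 1 \<le> i \<Longrightarrow> i \<le> 3 \<Longrightarrow>
      U n (i + 1) = U n 1 +
        (\<Sum>j = 1..i. matrix_fun (eerk31_a c\<^sub>2 (i + 1) j) ((- \<tau>) *\<^sub>R stab_L \<kappa> L) *v
           (\<tau> *\<^sub>R stab_g \<kappa> g (U n j) - \<tau> *\<^sub>R (stab_L \<kappa> L *v U n 1)))"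
    and step_end: "\<And>n. 1 \<le> n \<Longrightarrow> u n = U n 4"
  shows "\<forall>n \<ge> 1. \<forall>j \<in> {1..3}.
      energy L G (U n (j + 1)) - energy L G (U n 1)
        \<le> - (1 / \<tau>) * (\<Sum>k = 1..j. (U n (k + 1) - U n k) \<bullet>
              (\<Sum>l = 1..k. matrix_fun (eerk31_d c\<^sub>2 k l) ((- \<tau>) *\<^sub>R stab_L \<kappa> L) *v
                 (U n (l + 1) - U n l)))
    \<and> - (1 / \<tau>) * (\<Sum>k = 1..j. (U n (k + 1) - U n k) \<bullet>
              (\<Sum>l = 1..k. matrix_fun (eerk31_d c\<^sub>2 k l) ((- \<tau>) *\<^sub>R stab_L \<kappa> L) *v
                 (U n (l + 1) - U n l)))
        \<le> 0"
proof -
  define Z where "Z = (- \<tau>) *\<^sub>R stab_L \<kappa> L"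
  have c0: "0 < c\<^sub>2" and \<kappa>: "0 < \<kappa>" using c2 lg_pos kappa by simp_all
  have Lk: "stab_L \<kappa> L *v v = L *v v + \<kappa> *\<^sub>R v" for v
    by (simp add: stab_L_def matrix_vector_mult_add_rdistrib scaleR_matrix_vector_assoc[symmetric])
  have Zv: "Z *v v = (- \<tau>) *\<^sub>R (stab_L \<kappa> L *v v)" for v
    unfolding Z_def by (rule scaleR_matrix_vector_assoc[symmetric])
  have neg: "v \<bullet> (Z *v v) < 0" if "v \<noteq> 0" for v
  proof -
    have "0 < v \<bullet> (stab_L \<kappa> L *v v)"
      unfolding Lk inner_add_right using L_pos[OF that] \<kappa> that by (simp add: add_pos_pos)
    then show ?thesis unfolding Zv using tau by simp
  qed
  have "L $ j $ i = L $ i $ j" for i j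
    using arg_cong[OF L_sym, of "\<lambda>A. A $ i $ j"] by (simp add: transpose_def)
  then have "transpose Z = Z"
    by (simp add: Z_def stab_L_def transpose_def mat_def vec_eq_iff)
  then obtain Q d where Q: "orthogonal_matrix Q" and ZQ: "Z = Q ** diag_matrix d ** transpose Q"
    by (rule symmetric_matrix_diagonalizable)
  have d: "d i < 0" for i by (rule negative_definite_eigenvalue[OF Q ZQ neg])
  note coord = matrix_fun_coordinate[OF Q ZQ]
  define M where "M k l = matrix_fun (eerk31_d c\<^sub>2 k l) Z" for k l
  have ivl: "{1..1} = {1::nat}" "{1..2} = {1::nat, 2}" "{1..3} = {1::nat, 2, 3}" by auto
  have main: "energy L G (U n (j + 1)) - energy L G (U n 1)
        \<le> - (1 / \<tau>) * (\<Sum>k = 1..j. (U n (k + 1) - U n k) \<bullet> (\<Sum>l = 1..k. M k l *v (U n (l + 1) - U n l)))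
    \<and> - (1 / \<tau>) * (\<Sum>k = 1..j. (U n (k + 1) - U n k) \<bullet> (\<Sum>l = 1..k. M k l *v (U n (l + 1) - U n l))) \<le> 0"
    if n: "1 \<le> n" and j: "j \<in> {1..3}" for n j
  proof -
    define W where "W k = \<tau> *\<^sub>R stab_g \<kappa> g (U n k) - \<tau> *\<^sub>R (stab_L \<kappa> L *v U n 1)" for k
    have W: "W k = \<tau> *\<^sub>R stab_g \<kappa> g (U n k) + Z *v U n 1" for k
      by (simp add: W_def Zv)
    define s where "s k = U n (k + 1) - U n k" for k
    define R where "R k = (\<Sum>l = 1..k. M k l *v s l)" for k
    have step: "U n (i + 1) - U n 1 = (\<Sum>j = 1..i. matrix_fun (eerk31_a c\<^sub>2 (i + 1) j) Z *v W j)"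
      if "1 \<le> i" "i \<le> 3" for i
      using stage_step[OF n that] unfolding W_def Z_def by simp
    have R: "R k = \<tau> *\<^sub>R (stab_g \<kappa> g (U n k) - (1 / 2) *\<^sub>R (stab_L \<kappa> L *v (U n k + U n (k + 1))))"
      if "k \<in> {1, 2, 3}" for k
    proof (rule orthogonal_matrix_coordinates_eqI[OF Q])
      fix i
      let ?h = "\<lambda>v. column i Q \<bullet> v"
      have hZ: "?h (Z *v v) = d i * ?h v" for v
        using coord[of i "\<lambda>z. z" v] by (simp add: matrix_fun_id[OF Q ZQ])
      have hL: "\<tau> * ?h (stab_L \<kappa> L *v v) = - (d i * ?h v)" for v
        using hZ[of v] unfolding Zv by simp
      have a1: "?h (s 1) = eerk31_a c\<^sub>2 2 1 (d i) * ?h (W 1)"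
        using arg_cong[OF step[of 1], of ?h] by (simp add: s_def coord del: One_nat_def)
      have a2: "?h (s 1) + ?h (s 2) = eerk31_a c\<^sub>2 3 1 (d i) * ?h (W 1) + eerk31_a c\<^sub>2 3 2 (d i) * ?h (W 2)"
        using arg_cong[OF step[of 2], of ?h]
        by (simp add: ivl s_def coord inner_add_right inner_diff_right del: One_nat_def)
      have a3: "?h (s 1) + ?h (s 2) + ?h (s 3) = eerk31_a c\<^sub>2 4 1 (d i) * ?h (W 1)
          + eerk31_a c\<^sub>2 4 2 (d i) * ?h (W 2) + eerk31_a c\<^sub>2 4 3 (d i) * ?h (W 3)"
        using arg_cong[OF step[of 3], of ?h]
        by (simp add: ivl s_def coord inner_add_right inner_diff_right del: One_nat_def)
      note inv = eerk31_stage_inversion[OF d c0 a1 a2 a3]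
      \<comment> \<open>The increments before \<open>s k\<close> telescope to
        \<open>U n k - U n 1\<close>.\<close>
      have "?h (R k) = ?h (W k) + d i * (?h (U n k) - ?h (U n 1) + ?h (s k) / 2)"
        using that inv
        by (auto simp: R_def ivl M_def coord inner_add_right s_def inner_diff_right
            simp del: One_nat_def)
      \<comment> \<open>The term \<open>Z *v U n 1\<close> in \<open>W k\<close> cancels
        \<open>U n 1\<close>, leaving the midpoint of \<open>U n k\<close> and
        \<open>U n (k + 1)\<close>.\<close>
      also have "\<dots> = \<tau> * ?h (stab_g \<kappa> g (U n k)) + d i * (?h (U n k + U n (k + 1)) / 2)"
        by (simp add: W hZ s_def inner_add_right inner_diff_right field_simps)
      also have "\<dots> = ?h (\<tau> *\<^sub>R (stab_g \<kappa> g (U n k) - (1 / 2) *\<^sub>R (stab_L \<kappa> L *v (U n k + U n (k + 1)))))"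
        using hL[of "U n k + U n (k + 1)"] by (simp add: inner_diff_right right_diff_distrib)
      finally show "?h (R k) = \<dots>" .
    qed
    have descent: "energy L G (U n (k + 1)) - energy L G (U n k) \<le> - (1 / \<tau>) * (s k \<bullet> R k)"
      if "k \<in> {1, 2, 3}" for k
    proof -
      have "energy L G (U n (k + 1)) - energy L G (U n k)
          \<le> s k \<bullet> ((1 / 2) *\<^sub>R (stab_L \<kappa> L *v (U n k + U n (k + 1))) - stab_g \<kappa> g (U n k))"
        unfolding s_def by (rule energy_step[OF L_sym G_grad g_lip kappa])
      also have "\<dots> = - (1 / \<tau>) * (s k \<bullet> R k)"
        unfolding R[OF that] using tau by (simp add: inner_diff_right)
      finally show ?thesis .
    qed
    have pos: "0 \<le> v\<^sub>1 \<bullet> (M 1 1 *v v\<^sub>1) + v\<^sub>2 \<bullet> (M 2 1 *v v\<^sub>1 + M 2 2 *v v\<^sub>2)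
        + v\<^sub>3 \<bullet> (M 3 1 *v v\<^sub>1 + M 3 2 *v v\<^sub>2 + M 3 3 *v v\<^sub>3)" for v\<^sub>1 v\<^sub>2 v\<^sub>3
      unfolding M_def by (rule eerk31_d_matrix_form_nonneg[OF Q ZQ d c2])
    have Rs: "R 1 = M 1 1 *v s 1" "R 2 = M 2 1 *v s 1 + M 2 2 *v s 2"
      "R 3 = M 3 1 *v s 1 + M 3 2 *v s 2 + M 3 3 *v s 3"
      unfolding R_def ivl by (simp_all add: add.assoc)
    have "energy L G (U n (j + 1)) - energy L G (U n 1) \<le> - (1 / \<tau>) * (\<Sum>k = 1..j. s k \<bullet> R k)"
    proof -
      have "energy L G (U n (j + 1)) - energy L G (U n 1)
          = (\<Sum>k = 1..j. energy L G (U n (k + 1)) - energy L G (U n k))"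
        using sum_Suc_diff[of 1 j "\<lambda>k. energy L G (U n k)"] j by simp
      also have "\<dots> \<le> (\<Sum>k = 1..j. - (1 / \<tau>) * (s k \<bullet> R k))"
        using j by (intro sum_mono descent) auto
      finally show ?thesis by (simp only: sum_distrib_left)
    qed
    moreover have "0 \<le> (\<Sum>k = 1..j. s k \<bullet> R k)"
    proof -
      have "j = 1 \<or> j = 2 \<or> j = 3" using j by auto
      then show ?thesis
        using pos[of "s 1" 0 0] pos[of "s 1" "s 2" 0] pos[of "s 1" "s 2" "s 3"]
        by (auto simp: ivl Rs simp del: One_nat_def)
    qed
    ultimately show ?thesis using tau unfolding R_def s_def by simp
  qed
  then show ?thesis unfolding M_def Z_def by blast
qed

end
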